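(* For any Loday pseudoalgebra structure on an $\mathcal A$-module $\mathcal E$ there is a short exact sequence of morphisms of Loday pseudoalgebras over $\mathcal A$, $$0\longrightarrow\bar{\mathcal E}^0\longrightarrow\mathcal E\longrightarrow\bar{\mathcal E}\longrightarrow0,$$ where $\bar{\mathcal E}^0$, the $\mathcal A$-submodule of $\mathcal E$ generated by $\{[X,X]:X\in\mathcal E\}$, is a Loday pseudoalgebra with the trivial left anchor, and $\bar{\mathcal E}=\mathcal E/\bar{\mathcal E}^0$ is a Lie pseudoalgebra.
   Context: $\mathbb K$ is a field of characteristic $0$, $\mathcal A$ is an associative commutative unital $\mathbb K$-algebra, and it is a standing assumption that all the $\mathcal A$-modules are faithful (i.e. $fX=0$ for all $X$ in the module implies $f=0$). Let $\mathcal E$ be a faithful $\mathcal A$-module. For a $\mathbb K$-bilinear $B:\mathcal E\times\mathcal E\to\mathcal E$ and $f\in\mathcal A$ put $(\delta_1(f)B)(X,Y)=B(fX,Y)-fB(X,Y)$ and $(\delta_2(f)B)(X,Y)=B(X,fY)-fB(X,Y)$; $B$ is a bidifferential operator of total degree $\le1$ if $\delta_i(f)\delta_j(g)B=0$ for all $f,g\in\mathcal A$ and $i,j\in\{1,2\}$. A pseudoalgebra bracket on the faithful $\mathcal A$-module $\mathcal E$ is a bidifferential operator $B=[\cdot,\cdot]$ of total degree $\le1$ such that each $\mathrm{ad}_X=[X,\cdot]$ is a derivative endomorphism, i.e. for each $f\in\mathcal A$ there is $\widehat f\in\mathcal A$ with $[X,fY]-f[X,Y]=\widehat fY$ for all $Y\in\mathcal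 E$; then $\widehat f=\rho(X)(f)$ for a derivation $\rho(X)\in\mathrm{Der}(\mathcal A)$, and $\rho:\mathcal E\to\mathrm{Der}(\mathcal A)$ is called the (left) anchor. A pseudoalgebra is a faithful $\mathcal A$-module equipped with a pseudoalgebra bracket. It is a Loday pseudoalgebra if the bracket satisfies the Jacobi identity $[x,[y,z]]=[[x,y],z]+[y,[x,z]]$, and a Lie pseudoalgebra if the bracket is a Lie algebra bracket. The bracket and anchor on $\bar{\mathcal E}^0$ are the restrictions of those of $\mathcal E$; the bracket on $\bar{\mathcal E}$ is the one induced from $\mathcal E$, with anchor $\bar\rho([X])=\rho(X)$, where $[X]$ denotes the coset of $X$. Morphisms are $\mathcal A$-linear maps respecting brackets and left anchors. *)

theory Defs
  imports "HOL-Algebra.QuotRing" "HOL-Algebra.Module"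
begin

text \<open>
  Throughout, \<open>K\<close> is the ground field, \<open>A\<close> is a commutative \<open>K\<close>-algebra and \<open>E\<close> is an
  \<open>A\<close>-module; brackets \<open>B\<close> and anchors \<open>\<rho>\<close> only matter on the carriers. As usual in
  HOL-Algebra, the fields \<^const>\<open>mult\<close> and \<^const>\<open>one\<close> of a module record carry no meaning.
\<close>

definition ring_char_zero :: "('k, 'r) ring_scheme \<Rightarrow> bool" where
  "ring_char_zero K \<longleftrightarrow> (\<forall>n::nat. n > 0 \<longrightarrow> add_pow K n \<one>\<^bsub>K\<^esub> \<noteq> \<zero>\<^bsub>K\<^esub>)"

definition faithful_module ::
  "('a, 'r) ring_scheme \<Rightarrow> ('a, 'e, 't) module_scheme \<Rightarrow> bool" where
  "faithful_module A E \<longleftrightarrow>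
     module A E \<and>
     (\<forall>f\<in>carrier A. (\<forall>X\<in>carrier E. f \<odot>\<^bsub>E\<^esub> X = \<zero>\<^bsub>E\<^esub>) \<longrightarrow> f = \<zero>\<^bsub>A\<^esub>)"

definition derivation ::
  "('k, 'r) ring_scheme \<Rightarrow> ('k, 'a, 's) module_scheme \<Rightarrow> ('a \<Rightarrow> 'a) \<Rightarrow> bool" where
  "derivation K A D \<longleftrightarrow>
     D \<in> carrier A \<rightarrow> carrier A \<and>
     (\<forall>f\<in>carrier A. \<forall>g\<in>carrier A. D (f \<oplus>\<^bsub>A\<^esub> g) = D f \<oplus>\<^bsub>A\<^esub> D g) \<and>
     (\<forall>c\<in>carrier K. \<forall>f\<in>carrier A. D (c \<odot>\<^bsub>A\<^esub> f) = c \<odot>\<^bsub>A\<^esub> D f) \<and>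
     (\<forall>f\<in>carrier A. \<forall>g\<in>carrier A.
        D (f \<otimes>\<^bsub>A\<^esub> g) = (D f \<otimes>\<^bsub>A\<^esub> g) \<oplus>\<^bsub>A\<^esub> (f \<otimes>\<^bsub>A\<^esub> D g))"

text \<open>The action of a scalar \<open>c\<close> of \<open>K\<close> on \<open>E\<close> is that of \<open>c \<cdot> 1\<close> in \<open>A\<close>.\<close>

definition scalar_mult ::
  "('k, 'a, 's) module_scheme \<Rightarrow> ('a, 'e, 't) module_scheme \<Rightarrow> 'k \<Rightarrow> 'e \<Rightarrow> 'e" where
  "scalar_mult A E c X = (c \<odot>\<^bsub>A\<^esub> \<one>\<^bsub>A\<^esub>) \<odot>\<^bsub>E\<^esub> X"

definition bilinear_bracket ::
  "('k, 'r) ring_scheme \<Rightarrow> ('k, 'a, 's) module_scheme \<Rightarrow> ('a, 'e, 't) module_scheme \<Rightarrow>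
   ('e \<Rightarrow> 'e \<Rightarrow> 'e) \<Rightarrow> bool" where
  "bilinear_bracket K A E B \<longleftrightarrow>
     B \<in> carrier E \<rightarrow> carrier E \<rightarrow> carrier E \<and>
     (\<forall>X\<in>carrier E. \<forall>Y\<in>carrier E. \<forall>Z\<in>carrier E.
        B (X \<oplus>\<^bsub>E\<^esub> Y) Z = B X Z \<oplus>\<^bsub>E\<^esub> B Y Z \<and>
        B X (Y \<oplus>\<^bsub>E\<^esub> Z) = B X Y \<oplus>\<^bsub>E\<^esub> B X Z) \<and>
     (\<forall>c\<in>carrier K. \<forall>X\<in>carrier E. \<forall>Y\<in>carrier E.
        B (scalar_mult A E c X) Y = scalar_mult A E c (B X Y) \<and>
        B X (scalar_mult A E c Y) = scalar_mult A E c (B X Y))"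

definition delta1 ::
  "('a, 'e, 't) module_scheme \<Rightarrow> 'a \<Rightarrow> ('e \<Rightarrow> 'e \<Rightarrow> 'e) \<Rightarrow> 'e \<Rightarrow> 'e \<Rightarrow> 'e" where
  "delta1 E f B X Y = B (f \<odot>\<^bsub>E\<^esub> X) Y \<ominus>\<^bsub>E\<^esub> f \<odot>\<^bsub>E\<^esub> B X Y"

definition delta2 ::
  "('a, 'e, 't) module_scheme \<Rightarrow> 'a \<Rightarrow> ('e \<Rightarrow> 'e \<Rightarrow> 'e) \<Rightarrow> 'e \<Rightarrow> 'e \<Rightarrow> 'e" where
  "delta2 E f B X Y = B X (f \<odot>\<^bsub>E\<^esub> Y) \<ominus>\<^bsub>E\<^esub> f \<odot>\<^bsub>E\<^esub> B X Y"

definition bidiff_op_deg_le_1 ::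
  "('k, 'r) ring_scheme \<Rightarrow> ('k, 'a, 's) module_scheme \<Rightarrow> ('a, 'e, 't) module_scheme \<Rightarrow>
   ('e \<Rightarrow> 'e \<Rightarrow> 'e) \<Rightarrow> bool" where
  "bidiff_op_deg_le_1 K A E B \<longleftrightarrow>
     bilinear_bracket K A E B \<and>
     (\<forall>\<delta>\<in>{delta1 E, delta2 E}. \<forall>\<delta>'\<in>{delta1 E, delta2 E}.
        \<forall>f\<in>carrier A. \<forall>g\<in>carrier A. \<forall>X\<in>carrier E. \<forall>Y\<in>carrier E.
          \<delta> f (\<delta>' g B) X Y = \<zero>\<^bsub>E\<^esub>)"

text \<open>
  Faithfulness of \<open>E\<close> is deliberately not part of the next predicate; it is added in
  \<open>pseudoalgebra\<close> below.
\<close>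

definition pseudoalgebra_bracket ::
  "('k, 'r) ring_scheme \<Rightarrow> ('k, 'a, 's) module_scheme \<Rightarrow> ('a, 'e, 't) module_scheme \<Rightarrow>
   ('e \<Rightarrow> 'e \<Rightarrow> 'e) \<Rightarrow> bool" where
  "pseudoalgebra_bracket K A E B \<longleftrightarrow>
     bidiff_op_deg_le_1 K A E B \<and>
     (\<forall>X\<in>carrier E. \<forall>f\<in>carrier A. \<exists>h\<in>carrier A. \<forall>Y\<in>carrier E.
        B X (f \<odot>\<^bsub>E\<^esub> Y) \<ominus>\<^bsub>E\<^esub> f \<odot>\<^bsub>E\<^esub> B X Y = h \<odot>\<^bsub>E\<^esub> Y)"

definition pseudoalgebra ::
  "('k, 'r) ring_scheme \<Rightarrow> ('k, 'a, 's) module_scheme \<Rightarrow> ('a, 'e, 't) module_scheme \<Rightarrow>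
   ('e \<Rightarrow> 'e \<Rightarrow> 'e) \<Rightarrow> bool" where
  "pseudoalgebra K A E B \<longleftrightarrow> faithful_module A E \<and> pseudoalgebra_bracket K A E B"

text \<open>
  On a faithful module the element \<open>h\<close> above is unique; it is the value \<open>\<rho>(X)(f)\<close> of the anchor.
\<close>

definition anchor ::
  "('k, 'a, 's) module_scheme \<Rightarrow> ('a, 'e, 't) module_scheme \<Rightarrow> ('e \<Rightarrow> 'e \<Rightarrow> 'e) \<Rightarrow>
   'e \<Rightarrow> 'a \<Rightarrow> 'a" where
  "anchor A E B X f =
     (THE h. h \<in> carrier A \<and>
        (\<forall>Y\<in>carrier E. B X (f \<odot>\<^bsub>E\<^esub> Y) \<ominus>\<^bsub>E\<^esub> f \<odot>\<^bsub>E\<^esub> B X Y = h \<odot>\<^bsub>E\<^esub> Y))"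

definition jacobi_identity ::
  "('a, 'e, 't) module_scheme \<Rightarrow> ('e \<Rightarrow> 'e \<Rightarrow> 'e) \<Rightarrow> bool" where
  "jacobi_identity E B \<longleftrightarrow>
     (\<forall>X\<in>carrier E. \<forall>Y\<in>carrier E. \<forall>Z\<in>carrier E.
        B X (B Y Z) = B (B X Y) Z \<oplus>\<^bsub>E\<^esub> B Y (B X Z))"

definition alternating_bracket ::
  "('a, 'e, 't) module_scheme \<Rightarrow> ('e \<Rightarrow> 'e \<Rightarrow> 'e) \<Rightarrow> bool" where
  "alternating_bracket E B \<longleftrightarrow> (\<forall>X\<in>carrier E. B X X = \<zero>\<^bsub>E\<^esub>)"

definition loday_pseudoalgebra ::
  "('k, 'r) ring_scheme \<Rightarrow> ('k, 'a, 's) module_scheme \<Rightarrow> ('a, 'e, 't) module_scheme \<Rightarrow>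
   ('e \<Rightarrow> 'e \<Rightarrow> 'e) \<Rightarrow> bool" where
  "loday_pseudoalgebra K A E B \<longleftrightarrow> pseudoalgebra K A E B \<and> jacobi_identity E B"

definition lie_pseudoalgebra ::
  "('k, 'r) ring_scheme \<Rightarrow> ('k, 'a, 's) module_scheme \<Rightarrow> ('a, 'e, 't) module_scheme \<Rightarrow>
   ('e \<Rightarrow> 'e \<Rightarrow> 'e) \<Rightarrow> bool" where
  "lie_pseudoalgebra K A E B \<longleftrightarrow>
     pseudoalgebra K A E B \<and> alternating_bracket E B \<and> jacobi_identity E B"

text \<open>
  The same structures on a module that need not be faithful (such as the zero module). There the
  bracket no longer determines the anchor, so the anchor is given as part of the structure.
\<close>

definition anchored_pseudoalgebra ::
  "('k, 'r) ring_scheme \<Rightarrow> ('k, 'a, 's) module_scheme \<Rightarrow> ('a, 'e, 't) module_scheme \<Rightarrow>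
   ('e \<Rightarrow> 'e \<Rightarrow> 'e) \<Rightarrow> ('e \<Rightarrow> 'a \<Rightarrow> 'a) \<Rightarrow> bool" where
  "anchored_pseudoalgebra K A E B \<rho> \<longleftrightarrow>
     module A E \<and> pseudoalgebra_bracket K A E B \<and>
     (\<forall>X\<in>carrier E. derivation K A (\<rho> X)) \<and>
     (\<forall>X\<in>carrier E. \<forall>f\<in>carrier A. \<forall>Y\<in>carrier E.
        B X (f \<odot>\<^bsub>E\<^esub> Y) \<ominus>\<^bsub>E\<^esub> f \<odot>\<^bsub>E\<^esub> B X Y = \<rho> X f \<odot>\<^bsub>E\<^esub> Y)"

definition anchored_loday_pseudoalgebra ::
  "('k, 'r) ring_scheme \<Rightarrow> ('k, 'a, 's) module_scheme \<Rightarrow> ('a, 'e, 't) module_scheme \<Rightarrow>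
   ('e \<Rightarrow> 'e \<Rightarrow> 'e) \<Rightarrow> ('e \<Rightarrow> 'a \<Rightarrow> 'a) \<Rightarrow> bool" where
  "anchored_loday_pseudoalgebra K A E B \<rho> \<longleftrightarrow>
     anchored_pseudoalgebra K A E B \<rho> \<and> jacobi_identity E B"

definition anchored_lie_pseudoalgebra ::
  "('k, 'r) ring_scheme \<Rightarrow> ('k, 'a, 's) module_scheme \<Rightarrow> ('a, 'e, 't) module_scheme \<Rightarrow>
   ('e \<Rightarrow> 'e \<Rightarrow> 'e) \<Rightarrow> ('e \<Rightarrow> 'a \<Rightarrow> 'a) \<Rightarrow> bool" where
  "anchored_lie_pseudoalgebra K A E B \<rho> \<longleftrightarrow>
     anchored_pseudoalgebra K A E B \<rho> \<and> alternating_bracket E B \<and> jacobi_identity E B"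

definition anchors_agree ::
  "('k, 'a, 's) module_scheme \<Rightarrow> ('a, 'e, 't) module_scheme \<Rightarrow>
   ('e \<Rightarrow> 'a \<Rightarrow> 'a) \<Rightarrow> ('e \<Rightarrow> 'a \<Rightarrow> 'a) \<Rightarrow> bool" where
  "anchors_agree A E \<rho> \<sigma> \<longleftrightarrow> (\<forall>X\<in>carrier E. \<forall>f\<in>carrier A. \<rho> X f = \<sigma> X f)"

definition loday_morphism ::
  "('k, 'r) ring_scheme \<Rightarrow> ('k, 'a, 's) module_scheme \<Rightarrow>
   ('a, 'e, 't) module_scheme \<Rightarrow> ('e \<Rightarrow> 'e \<Rightarrow> 'e) \<Rightarrow> ('e \<Rightarrow> 'a \<Rightarrow> 'a) \<Rightarrow>
   ('a, 'd, 'u) module_scheme \<Rightarrow> ('d \<Rightarrow> 'd \<Rightarrow> 'd) \<Rightarrow> ('d \<Rightarrow> 'a \<Rightarrow> 'a) \<Rightarrow>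
   ('e \<Rightarrow> 'd) \<Rightarrow> bool" where
  "loday_morphism K A E B \<rho> E' B' \<rho>' \<phi> \<longleftrightarrow>
     anchored_loday_pseudoalgebra K A E B \<rho> \<and>
     anchored_loday_pseudoalgebra K A E' B' \<rho>' \<and>
     \<phi> \<in> carrier E \<rightarrow> carrier E' \<and>
     (\<forall>X\<in>carrier E. \<forall>Y\<in>carrier E. \<phi> (X \<oplus>\<^bsub>E\<^esub> Y) = \<phi> X \<oplus>\<^bsub>E'\<^esub> \<phi> Y) \<and>
     (\<forall>f\<in>carrier A. \<forall>X\<in>carrier E. \<phi> (f \<odot>\<^bsub>E\<^esub> X) = f \<odot>\<^bsub>E'\<^esub> \<phi> X) \<and>
     (\<forall>X\<in>carrier E. \<forall>Y\<in>carrier E. \<phi> (B X Y) = B' (\<phi> X) (\<phi> Y)) \<and>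
     (\<forall>X\<in>carrier E. \<forall>f\<in>carrier A. \<rho>' (\<phi> X) f = \<rho> X f)"

definition short_exact ::
  "('a, 'd, 'u) module_scheme \<Rightarrow> ('a, 'e, 't) module_scheme \<Rightarrow> ('a, 'c, 'v) module_scheme \<Rightarrow>
   ('d \<Rightarrow> 'e) \<Rightarrow> ('e \<Rightarrow> 'c) \<Rightarrow> bool" where
  "short_exact E' E E'' \<iota> \<pi> \<longleftrightarrow>
     inj_on \<iota> (carrier E') \<and> \<iota> ` carrier E' = a_kernel E E'' \<pi> \<and> \<pi> ` carrier E = carrier E''"

definition submodule_generated ::
  "('a, 'r) ring_scheme \<Rightarrow> ('a, 'e, 't) module_scheme \<Rightarrow> 'e set \<Rightarrow> 'e set" where
  "submodule_generated A E S = \<Inter>{N. submodule N A E \<and> S \<subseteq> N}"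

definition squares_submodule ::
  "('k, 'a, 's) module_scheme \<Rightarrow> ('a, 'e, 't) module_scheme \<Rightarrow> ('e \<Rightarrow> 'e \<Rightarrow> 'e) \<Rightarrow> 'e set" where
  "squares_submodule A E B = submodule_generated A E {B X X | X. X \<in> carrier E}"

text \<open>
  The operations on cosets follow the pattern of \<^const>\<open>rcoset_mult\<close>: the union over all
  representatives is a coset precisely when the operation is well defined.
\<close>

definition quotient_module ::
  "('a, 'e, 't) module_scheme \<Rightarrow> 'e set \<Rightarrow> ('a, 'e set) module" where
  "quotient_module E N =
     \<lparr>carrier = a_rcosets\<^bsub>E\<^esub> N, mult = undefined, one = undefined, zero = N, add = set_add E,
      smult = (\<lambda>f C. \<Union>X\<in>C. N +>\<^bsub>E\<^esub> (f \<odot>\<^bsub>E\<^esub> X))\<rparr>"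

definition quotient_bracket ::
  "('a, 'e, 't) module_scheme \<Rightarrow> 'e set \<Rightarrow> ('e \<Rightarrow> 'e \<Rightarrow> 'e) \<Rightarrow> 'e set \<Rightarrow> 'e set \<Rightarrow> 'e set" where
  "quotient_bracket E N B C D = (\<Union>X\<in>C. \<Union>Y\<in>D. N +>\<^bsub>E\<^esub> B X Y)"

text \<open>
  That the choice of representative is immaterial is part of the projection being a morphism.
\<close>

definition quotient_anchor :: "('e \<Rightarrow> 'a \<Rightarrow> 'a) \<Rightarrow> 'e set \<Rightarrow> 'a \<Rightarrow> 'a" where
  "quotient_anchor \<rho> C = \<rho> (SOME X. X \<in> C)"

end

theory Submission
  imports Defs
begin

text \<open>
  Write \<open>N\<close> for the submodule generated by the squares. Everything rests on three facts.

  The anchor vanishes on \<open>N\<close>. Expanding \<open>[X, [Y, f Z]]\<close> with the Jacobi identity gives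
  \<open>\<rho>([X, Y]) = \<rho>(X) \<rho>(Y) - \<rho>(Y) \<rho>(X)\<close>, so every square has anchor \<open>0\<close> (lemma \<open>anchor_bracket\<close>).
  This passes to the multiples \<open>f [X, X]\<close> because the anchor is \<open>A\<close>-linear, and that is what the bound
  on the total degree of the bracket provides: \<open>\<delta>\<^sub>1(g) \<delta>\<^sub>2(f) B = 0\<close> says
  \<open>\<rho>(g X)(f) = g \<rho>(X)(f)\<close> (lemma \<open>anchor_smult\<close>). Both arguments compare operators on \<open>E\<close> and
  cancel the module element by faithfulness.

  \<open>N\<close> is a left ideal. By the Jacobi identity \<open>[X, [Y, Y]] = [Z, Y] + [Y, Z]\<close> for \<open>Z = [X, Y]\<close>,
  and a symmetrized bracket is a combination of squares by polarization. The extra term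
  \<open>\<rho>(X)(f) n\<close> in \<open>[X, f n]\<close> stays in \<open>N\<close>.

  \<open>N\<close> is also a right ideal, because \<open>[n, X] + [X, n]\<close> is a symmetrized bracket.

  Hence the bracket restricts to \<open>N\<close>, and bracket and anchor descend to \<open>E / N\<close>, where all squares
  are \<open>0\<close>. The remaining axioms are identities between expressions in the module operations and the
  bracket. An injective map compatible with the brackets reflects such identities (for the inclusion
  of \<open>N\<close>) and a surjective one preserves them (for the projection); lemmas \<open>anchored_loday_inj\<close> and
  \<open>anchored_loday_surj\<close>.
\<close>

section \<open>Morphisms of modules with a bracket\<close>

lemma (in abelian_group) minus_eq_iff:
  assumes "a \<in> carrier G" "b \<in> carrier G" "c \<in> carrier G"
  shows "a \<ominus> b = c \<longleftrightarrow> a = b \<oplus> c"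
  using assms by (metis a_comm a_minus_def add.inv_closed add.inv_solve_right minus_closed)

locale module_morphism = src: module A E + tgt: module A E'
  for A :: "('a, 'r) ring_scheme" and E :: "('a, 'e, 't) module_scheme"
    and E' :: "('a, 'd, 'u) module_scheme" +
  fixes \<phi> :: "'e \<Rightarrow> 'd"
  assumes hom_closed [simp]: "X \<in> carrier E \<Longrightarrow> \<phi> X \<in> carrier E'"
    and hom_add: "\<lbrakk>X \<in> carrier E; Y \<in> carrier E\<rbrakk> \<Longrightarrow> \<phi> (X \<oplus>\<^bsub>E\<^esub> Y) = \<phi> X \<oplus>\<^bsub>E'\<^esub> \<phi> Y"
    and hom_smult: "\<lbrakk>f \<in> carrier A; X \<in> carrier E\<rbrakk> \<Longrightarrow> \<phi> (f \<odot>\<^bsub>E\<^esub> X) = f \<odot>\<^bsub>E'\<^esub> \<phi> X"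
begin

lemma abelian_group_hom: "abelian_group_hom E E' \<phi>"
  by (intro abelian_group_homI src.abelian_group_axioms tgt.abelian_group_axioms
      group_hom.intro group_hom_axioms.intro src.a_group tgt.a_group homI)
    (simp_all add: hom_add)

lemma hom_zero: "\<phi> \<zero>\<^bsub>E\<^esub> = \<zero>\<^bsub>E'\<^esub>"
  using abelian_group_hom by (rule abelian_group_hom.hom_zero)

lemma hom_minus:
  "\<lbrakk>X \<in> carrier E; Y \<in> carrier E\<rbrakk> \<Longrightarrow> \<phi> (X \<ominus>\<^bsub>E\<^esub> Y) = \<phi> X \<ominus>\<^bsub>E'\<^esub> \<phi> Y"
  using abelian_group_hom by (simp add: a_minus_def hom_add abelian_group_hom.hom_a_inv)

text \<open>
  The closure condition on \<open>B\<close> is included so that the relation is inherited by \<open>\<delta>\<^sub>1(f) B\<close> and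
  \<open>\<delta>\<^sub>2(f) B\<close> and can be iterated.
\<close>

definition intertwines :: "('e \<Rightarrow> 'e \<Rightarrow> 'e) \<Rightarrow> ('d \<Rightarrow> 'd \<Rightarrow> 'd) \<Rightarrow> bool" where
  "intertwines B B' \<longleftrightarrow> (\<forall>X\<in>carrier E. \<forall>Y\<in>carrier E.
     B X Y \<in> carrier E \<and> \<phi> (B X Y) = B' (\<phi> X) (\<phi> Y))"

lemma intertwinesD:
  assumes "intertwines B B'" "X \<in> carrier E" "Y \<in> carrier E"
  shows "B X Y \<in> carrier E" "\<phi> (B X Y) = B' (\<phi> X) (\<phi> Y)"
  using assms by (auto simp: intertwines_def)

lemma intertwines_delta1:
  "\<lbrakk>intertwines B B'; f \<in> carrier A\<rbrakk> \<Longrightarrow> intertwines (delta1 E f B) (delta1 E' f B')"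
  by (simp add: intertwines_def delta1_def hom_minus hom_smult)

lemma intertwines_delta2:
  "\<lbrakk>intertwines B B'; f \<in> carrier A\<rbrakk> \<Longrightarrow> intertwines (delta2 E f B) (delta2 E' f B')"
  by (simp add: intertwines_def delta2_def hom_minus hom_smult)

lemma intertwines_delta_delta:
  assumes "intertwines B B'" "f \<in> carrier A" "g \<in> carrier A"
  shows "intertwines (delta1 E f (delta1 E g B)) (delta1 E' f (delta1 E' g B'))"
    and "intertwines (delta1 E f (delta2 E g B)) (delta1 E' f (delta2 E' g B'))"
    and "intertwines (delta2 E f (delta1 E g B)) (delta2 E' f (delta1 E' g B'))"
    and "intertwines (delta2 E f (delta2 E g B)) (delta2 E' f (delta2 E' g B'))"
  using assms by (simp_all add: intertwines_delta1 intertwines_delta2)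

end

locale anchored_morphism = module_morphism A E E' \<phi>
  for A :: "('k, 'a, 's) module_scheme" and E :: "('a, 'e, 't) module_scheme"
    and E' :: "('a, 'd, 'u) module_scheme" and \<phi> +
  fixes K :: "('k, 'r) ring_scheme"
    and B :: "'e \<Rightarrow> 'e \<Rightarrow> 'e" and \<rho> :: "'e \<Rightarrow> 'a \<Rightarrow> 'a"
    and B' :: "'d \<Rightarrow> 'd \<Rightarrow> 'd" and \<rho>' :: "'d \<Rightarrow> 'a \<Rightarrow> 'a"
  assumes ground: "module K A"
    and bracket: "intertwines B B'"
    and hom_anchor: "\<lbrakk>X \<in> carrier E; f \<in> carrier A\<rbrakk> \<Longrightarrow> \<rho>' (\<phi> X) f = \<rho> X f"
begin

lemmas bracket_closed [simp] = intertwinesD(1)[OF bracket]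
  and hom_bracket = intertwinesD(2)[OF bracket]

lemma hom_scalar_mult:
  assumes "c \<in> carrier K" "X \<in> carrier E"
  shows "scalar_mult A E c X \<in> carrier E"
    and "\<phi> (scalar_mult A E c X) = scalar_mult A E' c (\<phi> X)"
  using assms module.smult_closed[OF ground assms(1) src.R.one_closed]
  by (simp_all add: scalar_mult_def hom_smult)

lemma derivation_anchor_iff:
  assumes "X \<in> carrier E"
  shows "derivation K A (\<rho>' (\<phi> X)) \<longleftrightarrow> derivation K A (\<rho> X)"
  using assms module.smult_closed[OF ground]
  by (simp add: derivation_def hom_anchor Pi_iff)

text \<open>
  Each axiom is an identity quantified over elements of \<^term>\<open>E'\<close>. Writing these elements as
  \<^term>\<open>\<phi> X\<close> turns both sides into the image under \<^term>\<open>\<phi>\<close> of the two sides of the same identity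
  in \<^term>\<open>E\<close>.
\<close>

lemma bidiff_op_surj:
  assumes surj: "\<phi> ` carrier E = carrier E'" and "bidiff_op_deg_le_1 K A E B"
  shows "bidiff_op_deg_le_1 K A E' B'"
proof -
  have "bilinear_bracket K A E' B'"
    using assms(2) unfolding bidiff_op_deg_le_1_def bilinear_bracket_def surj[symmetric] Pi_iff
    by (simp add: hom_add[symmetric] hom_bracket[symmetric]
        hom_scalar_mult(2)[symmetric] hom_scalar_mult(1))
  then show ?thesis
    using assms(2) unfolding bidiff_op_deg_le_1_def surj[symmetric]
    by (simp add: intertwines_delta_delta[OF bracket, THEN intertwinesD(2), symmetric] hom_zero)
qed

text \<open>
  Conversely, both sides of an identity in \<^term>\<open>E\<close> have the same image under \<^term>\<open>\<phi>\<close> as soon as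
  the identity holds in \<^term>\<open>E'\<close>; injectivity of \<^term>\<open>\<phi>\<close> removes the image.
\<close>

lemma bidiff_op_inj:
  assumes inj: "inj_on \<phi> (carrier E)" and "bidiff_op_deg_le_1 K A E' B'"
  shows "bidiff_op_deg_le_1 K A E B"
proof -
  note eqI = inj_onD[OF inj]
  have "bilinear_bracket K A E B"
    using assms(2) unfolding bidiff_op_deg_le_1_def bilinear_bracket_def
    by (auto intro!: eqI simp: hom_add hom_bracket hom_scalar_mult)
  moreover have "D X Y = \<zero>\<^bsub>E\<^esub>"
    if "intertwines D D'" "D' (\<phi> X) (\<phi> Y) = \<zero>\<^bsub>E'\<^esub>" "X \<in> carrier E" "Y \<in> carrier E" for D D' X Y
    using that by (intro eqI) (simp_all add: intertwinesD[OF that(1)] hom_zero)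
  note this[OF intertwines_delta_delta(1)[OF bracket]]
    this[OF intertwines_delta_delta(2)[OF bracket]]
    this[OF intertwines_delta_delta(3)[OF bracket]]
    this[OF intertwines_delta_delta(4)[OF bracket]]
  ultimately show ?thesis
    using assms(2) unfolding bidiff_op_deg_le_1_def by simp
qed

lemma hom_derivative_rule:
  assumes "X \<in> carrier E" "f \<in> carrier A" "Y \<in> carrier E" "\<rho> X f \<in> carrier A"
  shows "\<phi> (B X (f \<odot>\<^bsub>E\<^esub> Y) \<ominus>\<^bsub>E\<^esub> f \<odot>\<^bsub>E\<^esub> B X Y) =
           B' (\<phi> X) (f \<odot>\<^bsub>E'\<^esub> \<phi> Y) \<ominus>\<^bsub>E'\<^esub> f \<odot>\<^bsub>E'\<^esub> B' (\<phi> X) (\<phi> Y)"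
    and "\<phi> (\<rho> X f \<odot>\<^bsub>E\<^esub> Y) = \<rho>' (\<phi> X) f \<odot>\<^bsub>E'\<^esub> \<phi> Y"
  using assms by (simp_all add: hom_minus hom_smult hom_bracket hom_anchor)

lemma anchored_loday_surj:
  assumes surj: "\<phi> ` carrier E = carrier E'" and loday: "anchored_loday_pseudoalgebra K A E B \<rho>"
  shows "anchored_loday_pseudoalgebra K A E' B' \<rho>'"
proof -
  from loday have bidiff: "bidiff_op_deg_le_1 K A E B"
    and der: "\<And>X. X \<in> carrier E \<Longrightarrow> derivation K A (\<rho> X)"
    and rule: "\<And>X f Y. \<lbrakk>X \<in> carrier E; f \<in> carrier A; Y \<in> carrier E\<rbrakk> \<Longrightarrow>
      B X (f \<odot>\<^bsub>E\<^esub> Y) \<ominus>\<^bsub>E\<^esub> f \<odot>\<^bsub>E\<^esub> B X Y = \<rho> X f \<odot>\<^bsub>E\<^esub> Y"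
    and jac: "jacobi_identity E B"
    by (auto simp: anchored_loday_pseudoalgebra_def anchored_pseudoalgebra_def
        pseudoalgebra_bracket_def)
  have closed: "\<rho> X f \<in> carrier A" if "X \<in> carrier E" "f \<in> carrier A" for X f
    using der[OF that(1)] that(2) by (auto simp: derivation_def)
  have rule': "\<forall>X\<in>carrier E'. \<forall>f\<in>carrier A. \<forall>Y\<in>carrier E'.
      B' X (f \<odot>\<^bsub>E'\<^esub> Y) \<ominus>\<^bsub>E'\<^esub> f \<odot>\<^bsub>E'\<^esub> B' X Y = \<rho>' X f \<odot>\<^bsub>E'\<^esub> Y"
    unfolding surj[symmetric] by (simp add: hom_derivative_rule[symmetric] closed rule)
  have closed': "\<forall>X\<in>carrier E'. \<forall>f\<in>carrier A. \<rho>' X f \<in> carrier A"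
    unfolding surj[symmetric] by (simp add: closed hom_anchor)
  have "pseudoalgebra_bracket K A E' B'"
    unfolding pseudoalgebra_bracket_def using bidiff_op_surj[OF surj bidiff] rule' closed' by blast
  moreover have "\<forall>X\<in>carrier E'. derivation K A (\<rho>' X)"
    unfolding surj[symmetric] by (simp add: derivation_anchor_iff der)
  moreover have "jacobi_identity E' B'"
    unfolding jacobi_identity_def surj[symmetric]
  proof (simp add: hom_bracket[symmetric] hom_add[symmetric], intro ballI)
    fix X Y Z assume "X \<in> carrier E" "Y \<in> carrier E" "Z \<in> carrier E"
    then show "\<phi> (B X (B Y Z)) = \<phi> (B (B X Y) Z \<oplus>\<^bsub>E\<^esub> B Y (B X Z))"
      using jac unfolding jacobi_identity_def by metis
  qed
  ultimately show ?thesis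
    using rule' tgt.module_axioms
    by (simp add: anchored_loday_pseudoalgebra_def anchored_pseudoalgebra_def)
qed

lemma anchored_loday_inj:
  assumes inj: "inj_on \<phi> (carrier E)" and loday: "anchored_loday_pseudoalgebra K A E' B' \<rho>'"
  shows "anchored_loday_pseudoalgebra K A E B \<rho>"
proof -
  from loday have bidiff: "bidiff_op_deg_le_1 K A E' B'"
    and der: "\<And>X. X \<in> carrier E' \<Longrightarrow> derivation K A (\<rho>' X)"
    and rule: "\<And>X f Y. \<lbrakk>X \<in> carrier E'; f \<in> carrier A; Y \<in> carrier E'\<rbrakk> \<Longrightarrow>
      B' X (f \<odot>\<^bsub>E'\<^esub> Y) \<ominus>\<^bsub>E'\<^esub> f \<odot>\<^bsub>E'\<^esub> B' X Y = \<rho>' X f \<odot>\<^bsub>E'\<^esub> Y"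
    and jac: "jacobi_identity E' B'"
    by (auto simp: anchored_loday_pseudoalgebra_def anchored_pseudoalgebra_def
        pseudoalgebra_bracket_def)
  note eqI = inj_onD[OF inj]
  have der': "\<forall>X\<in>carrier E. derivation K A (\<rho> X)"
    using der derivation_anchor_iff by simp
  then have closed: "\<rho> X f \<in> carrier A" if "X \<in> carrier E" "f \<in> carrier A" for X f
    using that by (auto simp: derivation_def)
  have rule': "\<forall>X\<in>carrier E. \<forall>f\<in>carrier A. \<forall>Y\<in>carrier E.
      B X (f \<odot>\<^bsub>E\<^esub> Y) \<ominus>\<^bsub>E\<^esub> f \<odot>\<^bsub>E\<^esub> B X Y = \<rho> X f \<odot>\<^bsub>E\<^esub> Y"
    by (intro ballI eqI) (simp_all add: hom_derivative_rule closed rule)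
  have "pseudoalgebra_bracket K A E B"
    unfolding pseudoalgebra_bracket_def using bidiff_op_inj[OF inj bidiff] rule' closed by blast
  moreover have "jacobi_identity E B"
    unfolding jacobi_identity_def
  proof (intro ballI eqI)
    fix X Y Z assume XYZ: "X \<in> carrier E" "Y \<in> carrier E" "Z \<in> carrier E"
    then have "B' (\<phi> X) (B' (\<phi> Y) (\<phi> Z)) =
        B' (B' (\<phi> X) (\<phi> Y)) (\<phi> Z) \<oplus>\<^bsub>E'\<^esub> B' (\<phi> Y) (B' (\<phi> X) (\<phi> Z))"
      using jac hom_closed unfolding jacobi_identity_def by blast
    with XYZ show "\<phi> (B X (B Y Z)) = \<phi> (B (B X Y) Z \<oplus>\<^bsub>E\<^esub> B Y (B X Z))"
      by (simp add: hom_bracket hom_add)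
  qed simp_all
  ultimately show ?thesis
    using rule' der' src.module_axioms
    by (simp add: anchored_loday_pseudoalgebra_def anchored_pseudoalgebra_def)
qed

end

section \<open>The anchor of a Loday pseudoalgebra\<close>

text \<open>
  If \<open>h\<close> and \<open>k\<close> both describe \<open>[X, f Y] - f [X, Y]\<close>, then \<open>h - k\<close> annihilates \<open>E\<close>, so it is \<open>0\<close>.
  The algebraic rules for the anchor below follow by comparing coefficients in this way.
\<close>

lemma anchor_eqI:
  assumes faithful: "faithful_module A E"
    and "h \<in> carrier A"
    and rule: "\<And>Y. Y \<in> carrier E \<Longrightarrow> B X (f \<odot>\<^bsub>E\<^esub> Y) \<ominus>\<^bsub>E\<^esub> f \<odot>\<^bsub>E\<^esub> B X Y = h \<odot>\<^bsub>E\<^esub> Y"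
  shows "anchor A E B X f = h"
proof -
  interpret E: module A E
    using faithful by (simp add: faithful_module_def)
  show ?thesis
    unfolding anchor_def
  proof (rule the_equality)
    fix k
    assume k: "k \<in> carrier A \<and> (\<forall>Y\<in>carrier E.
      B X (f \<odot>\<^bsub>E\<^esub> Y) \<ominus>\<^bsub>E\<^esub> f \<odot>\<^bsub>E\<^esub> B X Y = k \<odot>\<^bsub>E\<^esub> Y)"
    have "(k \<ominus>\<^bsub>A\<^esub> h) \<odot>\<^bsub>E\<^esub> Y = \<zero>\<^bsub>E\<^esub>" if "Y \<in> carrier E" for Y
      using k rule[OF that] that \<open>h \<in> carrier A\<close>
      by (simp add: a_minus_def E.smult_l_distr E.smult_l_minus E.M.r_neg)
    then have "k \<ominus>\<^bsub>A\<^esub> h = \<zero>\<^bsub>A\<^esub>"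
      using faithful k \<open>h \<in> carrier A\<close> by (simp add: faithful_module_def)
    then show "k = h"
      using k \<open>h \<in> carrier A\<close> by (simp add: E.R.minus_eq_iff)
  qed (use assms in auto)
qed

lemma anchored_anchors_agree:
  assumes "faithful_module A E" "anchored_pseudoalgebra K A E B \<rho>"
  shows "anchors_agree A E (anchor A E B) \<rho>"
  using assms by (auto simp: anchors_agree_def anchored_pseudoalgebra_def derivation_def Pi_iff
      intro!: anchor_eqI)

locale faithful_loday =
  fixes K :: "('k, 'r) ring_scheme"
    and A :: "('k, 'a, 's) module_scheme"
    and E :: "('a, 'e, 't) module_scheme"
    and B :: "'e \<Rightarrow> 'e \<Rightarrow> 'e"
  assumes ground: "algebra K A"
    and loday: "loday_pseudoalgebra K A E B"
begin

sublocale A: algebra K A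
  by (rule ground)

lemma faithful: "faithful_module A E"
  and bidiff: "bidiff_op_deg_le_1 K A E B"
  and derivative: "\<lbrakk>X \<in> carrier E; f \<in> carrier A\<rbrakk> \<Longrightarrow> \<exists>h\<in>carrier A. \<forall>Y\<in>carrier E.
        B X (f \<odot>\<^bsub>E\<^esub> Y) \<ominus>\<^bsub>E\<^esub> f \<odot>\<^bsub>E\<^esub> B X Y = h \<odot>\<^bsub>E\<^esub> Y"
  and jacobi: "jacobi_identity E B"
  using loday
  by (auto simp: loday_pseudoalgebra_def pseudoalgebra_def pseudoalgebra_bracket_def)

sublocale E: module A E
  using faithful by (simp add: faithful_module_def)

abbreviation anch :: "'e \<Rightarrow> 'a \<Rightarrow> 'a" where
  "anch \<equiv> anchor A E B"

lemma bracket_closed [simp]: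
  "\<lbrakk>X \<in> carrier E; Y \<in> carrier E\<rbrakk> \<Longrightarrow> B X Y \<in> carrier E"
  using bidiff by (auto simp: bidiff_op_deg_le_1_def bilinear_bracket_def)

lemma bracket_add:
  assumes "X \<in> carrier E" "Y \<in> carrier E" "Z \<in> carrier E"
  shows "B (X \<oplus>\<^bsub>E\<^esub> Y) Z = B X Z \<oplus>\<^bsub>E\<^esub> B Y Z"
    and "B X (Y \<oplus>\<^bsub>E\<^esub> Z) = B X Y \<oplus>\<^bsub>E\<^esub> B X Z"
  using assms bidiff by (auto simp: bidiff_op_deg_le_1_def bilinear_bracket_def)

lemma bracket_zero [simp]:
  assumes "X \<in> carrier E"
  shows "B \<zero>\<^bsub>E\<^esub> X = \<zero>\<^bsub>E\<^esub>" and "B X \<zero>\<^bsub>E\<^esub> = \<zero>\<^bsub>E\<^esub>"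
proof -
  have idem: "x = \<zero>\<^bsub>E\<^esub>" if "x \<oplus>\<^bsub>E\<^esub> x = x" "x \<in> carrier E" for x
    using that by (simp add: E.M.add.l_cancel_one)
  show "B \<zero>\<^bsub>E\<^esub> X = \<zero>\<^bsub>E\<^esub>"
    using assms by (intro idem) (simp_all add: bracket_add(1)[symmetric])
  show "B X \<zero>\<^bsub>E\<^esub> = \<zero>\<^bsub>E\<^esub>"
    using assms by (intro idem) (simp_all add: bracket_add(2)[symmetric])
qed

lemma bracket_jacobi:
  "\<lbrakk>X \<in> carrier E; Y \<in> carrier E; Z \<in> carrier E\<rbrakk> \<Longrightarrow>
     B X (B Y Z) = B (B X Y) Z \<oplus>\<^bsub>E\<^esub> B Y (B X Z)"
  using jacobi unfolding jacobi_identity_def by blast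

lemma
  assumes X: "X \<in> carrier E" and f: "f \<in> carrier A"
  shows anchor_closed [simp]: "anch X f \<in> carrier A"
    and delta2_bracket: "Y \<in> carrier E \<Longrightarrow> delta2 E f B X Y = anch X f \<odot>\<^bsub>E\<^esub> Y"
proof -
  obtain h where h: "h \<in> carrier A" and rule: "\<And>Y. Y \<in> carrier E \<Longrightarrow>
      B X (f \<odot>\<^bsub>E\<^esub> Y) \<ominus>\<^bsub>E\<^esub> f \<odot>\<^bsub>E\<^esub> B X Y = h \<odot>\<^bsub>E\<^esub> Y"
    using derivative[OF X f] by blast
  have anch: "anch X f = h"
    by (intro anchor_eqI faithful h rule)
  show "anch X f \<in> carrier A"
    using h by (simp add: anch)
  show "delta2 E f B X Y = anch X f \<odot>\<^bsub>E\<^esub> Y" if "Y \<in> carrier E"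
    using rule[OF that] by (simp add: anch delta2_def)
qed

lemma bracket_smult:
  assumes "X \<in> carrier E" "f \<in> carrier A" "Y \<in> carrier E"
  shows "B X (f \<odot>\<^bsub>E\<^esub> Y) = f \<odot>\<^bsub>E\<^esub> B X Y \<oplus>\<^bsub>E\<^esub> anch X f \<odot>\<^bsub>E\<^esub> Y"
  using delta2_bracket[OF assms] assms by (simp add: delta2_def E.M.minus_eq_iff)

lemma anchor_eq:
  assumes "X \<in> carrier E" "f \<in> carrier A" "h \<in> carrier A"
    and "\<And>Y. Y \<in> carrier E \<Longrightarrow> B X (f \<odot>\<^bsub>E\<^esub> Y) = f \<odot>\<^bsub>E\<^esub> B X Y \<oplus>\<^bsub>E\<^esub> h \<odot>\<^bsub>E\<^esub> Y"
  shows "anch X f = h"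
  using assms by (intro anchor_eqI[OF faithful]) (simp_all add: E.M.minus_eq_iff)

lemma anchor_add_fun:
  assumes "X \<in> carrier E" "f \<in> carrier A" "g \<in> carrier A"
  shows "anch X (f \<oplus>\<^bsub>A\<^esub> g) = anch X f \<oplus>\<^bsub>A\<^esub> anch X g"
  using assms
  by (intro anchor_eq) (simp_all add: E.smult_l_distr bracket_add bracket_smult E.M.a_ac)

text \<open>
  The Leibniz rule comes from moving the factors of \<open>[X, f (g Y)]\<close> out of the bracket one at a time.
\<close>

lemma anchor_mult_fun:
  assumes "X \<in> carrier E" "f \<in> carrier A" "g \<in> carrier A"
  shows "anch X (f \<otimes>\<^bsub>A\<^esub> g) = anch X f \<otimes>\<^bsub>A\<^esub> g \<oplus>\<^bsub>A\<^esub> f \<otimes>\<^bsub>A\<^esub> anch X g"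
  using assms
  by (intro anchor_eq)
    (simp_all add: E.smult_l_distr E.smult_r_distr E.smult_assoc1 bracket_add bracket_smult E.M.a_ac)

lemma anchor_const:
  assumes "X \<in> carrier E" "c \<in> carrier K"
  shows "anch X (c \<odot>\<^bsub>A\<^esub> \<one>\<^bsub>A\<^esub>) = \<zero>\<^bsub>A\<^esub>"
  using assms bidiff
  by (intro anchor_eq) (simp_all add: bidiff_op_deg_le_1_def bilinear_bracket_def scalar_mult_def)

lemma derivation_anchor:
  assumes X: "X \<in> carrier E"
  shows "derivation K A (anch X)"
proof -
  have "anch X (c \<odot>\<^bsub>A\<^esub> f) = c \<odot>\<^bsub>A\<^esub> anch X f" if "c \<in> carrier K" "f \<in> carrier A" for c f
  proof -
    \<comment> \<open>linearity over \<open>K\<close> is the Leibniz rule for the constant \<open>c \<cdot> 1\<close>, whose derivative is \<open>0\<close>\<close>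
    have as_mult: "c \<odot>\<^bsub>A\<^esub> g = (c \<odot>\<^bsub>A\<^esub> \<one>\<^bsub>A\<^esub>) \<otimes>\<^bsub>A\<^esub> g" if "g \<in> carrier A" for g
      using that \<open>c \<in> carrier K\<close> by (simp add: A.smult_assoc2)
    show ?thesis
      using X that by (simp add: as_mult[of f] as_mult[of "anch X f"] anchor_mult_fun anchor_const)
  qed
  then show ?thesis
    using X by (simp add: derivation_def anchor_add_fun anchor_mult_fun)
qed

lemma anchored_loday: "anchored_loday_pseudoalgebra K A E B anch"
  using loday derivation_anchor delta2_bracket E.module_axioms
  by (simp add: anchored_loday_pseudoalgebra_def anchored_pseudoalgebra_def
      loday_pseudoalgebra_def pseudoalgebra_def delta2_def)

lemma anchor_zero: "f \<in> carrier A \<Longrightarrow> anch \<zero>\<^bsub>E\<^esub> f = \<zero>\<^bsub>A\<^esub>"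
  by (rule anchor_eq) simp_all

lemma anchor_add:
  assumes X: "X \<in> carrier E" and Y: "Y \<in> carrier E" and f: "f \<in> carrier A"
  shows "anch (X \<oplus>\<^bsub>E\<^esub> Y) f = anch X f \<oplus>\<^bsub>A\<^esub> anch Y f"
proof (rule anchor_eq)
  fix Z assume Z: "Z \<in> carrier E"
  then have "B (X \<oplus>\<^bsub>E\<^esub> Y) (f \<odot>\<^bsub>E\<^esub> Z) = B X (f \<odot>\<^bsub>E\<^esub> Z) \<oplus>\<^bsub>E\<^esub> B Y (f \<odot>\<^bsub>E\<^esub> Z)"
    using X Y f by (simp only: bracket_add E.smult_closed)
  then show "B (X \<oplus>\<^bsub>E\<^esub> Y) (f \<odot>\<^bsub>E\<^esub> Z) =
      f \<odot>\<^bsub>E\<^esub> B (X \<oplus>\<^bsub>E\<^esub> Y) Z \<oplus>\<^bsub>E\<^esub> (anch X f \<oplus>\<^bsub>A\<^esub> anch Y f) \<odot>\<^bsub>E\<^esub> Z"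
    using X Y Z f
    by (simp add: bracket_smult[OF X] bracket_smult[OF Y] bracket_add E.smult_l_distr
        E.smult_r_distr E.M.a_ac)
qed (use X Y f in simp_all)

text \<open>
  Since \<open>\<delta>\<^sub>2(f) B (X, Y) = \<rho>(X)(f) Y\<close>, the condition \<open>\<delta>\<^sub>1(g) \<delta>\<^sub>2(f) B = 0\<close> reads
  \<open>\<rho>(g X)(f) Y = g \<rho>(X)(f) Y\<close>.
\<close>

lemma anchor_smult:
  assumes "g \<in> carrier A" "X \<in> carrier E" "f \<in> carrier A"
  shows "anch (g \<odot>\<^bsub>E\<^esub> X) f = g \<otimes>\<^bsub>A\<^esub> anch X f"
proof (rule anchor_eqI[OF faithful])
  fix Y assume Y: "Y \<in> carrier E"
  have "delta1 E g (delta2 E f B) X Y = \<zero>\<^bsub>E\<^esub>"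
    using bidiff assms Y by (simp add: bidiff_op_deg_le_1_def)
  then have "delta2 E f B (g \<odot>\<^bsub>E\<^esub> X) Y = g \<odot>\<^bsub>E\<^esub> (anch X f \<odot>\<^bsub>E\<^esub> Y)"
    using assms Y by (simp add: delta1_def delta2_bracket E.M.minus_eq_iff)
  then show "B (g \<odot>\<^bsub>E\<^esub> X) (f \<odot>\<^bsub>E\<^esub> Y) \<ominus>\<^bsub>E\<^esub> f \<odot>\<^bsub>E\<^esub> B (g \<odot>\<^bsub>E\<^esub> X) Y = (g \<otimes>\<^bsub>A\<^esub> anch X f) \<odot>\<^bsub>E\<^esub> Y"
    using assms Y unfolding delta2_def by (simp add: E.smult_assoc1)
qed (use assms in simp)

text \<open>
  Compare the expansions of the three terms of the Jacobi identity for \<open>X\<close>, \<open>Y\<close>, \<open>f Z\<close>. The mixed terms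
  \<open>p\<close>, with one derivative of \<open>f\<close>, occur in both iterated brackets and cancel, as does \<open>q\<close>. By the
  Jacobi identity for \<open>X\<close>, \<open>Y\<close>, \<open>Z\<close> the terms without derivative reduce to \<open>w\<close>.
\<close>

lemma anchor_bracket:
  assumes X: "X \<in> carrier E" and Y: "Y \<in> carrier E" and f: "f \<in> carrier A"
  shows "anch (B X Y) f = anch X (anch Y f) \<ominus>\<^bsub>A\<^esub> anch Y (anch X f)"
proof (rule anchor_eq)
  fix Z assume Z: "Z \<in> carrier E"
  note simps = bracket_smult bracket_add E.smult_r_distr
  define p where "p = anch X f \<odot>\<^bsub>E\<^esub> B Y Z \<oplus>\<^bsub>E\<^esub> anch Y f \<odot>\<^bsub>E\<^esub> B X Z"
  define q where "q = f \<odot>\<^bsub>E\<^esub> B Y (B X Z)"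
  define u where "u = anch X (anch Y f) \<odot>\<^bsub>E\<^esub> Z"
  define v where "v = anch Y (anch X f) \<odot>\<^bsub>E\<^esub> Z"
  define w where "w = f \<odot>\<^bsub>E\<^esub> B (B X Y) Z"
  define l where "l = B (B X Y) (f \<odot>\<^bsub>E\<^esub> Z)"
  note defs = p_def q_def u_def v_def w_def l_def
  have closed: "p \<in> carrier E" "q \<in> carrier E" "u \<in> carrier E" "v \<in> carrier E"
    "w \<in> carrier E" "l \<in> carrier E"
    using X Y Z f by (simp_all add: defs)
  have "B X (B Y (f \<odot>\<^bsub>E\<^esub> Z)) = (w \<oplus>\<^bsub>E\<^esub> q) \<oplus>\<^bsub>E\<^esub> p \<oplus>\<^bsub>E\<^esub> u"
    using X Y Z f by (simp add: simps defs bracket_jacobi[of X Y Z] E.M.a_ac)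
  moreover have "B Y (B X (f \<odot>\<^bsub>E\<^esub> Z)) = q \<oplus>\<^bsub>E\<^esub> p \<oplus>\<^bsub>E\<^esub> v"
    using X Y Z f by (simp add: simps defs E.M.a_ac)
  moreover have "B X (B Y (f \<odot>\<^bsub>E\<^esub> Z)) = l \<oplus>\<^bsub>E\<^esub> B Y (B X (f \<odot>\<^bsub>E\<^esub> Z))"
    using X Y Z f by (simp add: l_def bracket_jacobi[of X Y "f \<odot>\<^bsub>E\<^esub> Z"])
  ultimately have "(q \<oplus>\<^bsub>E\<^esub> p) \<oplus>\<^bsub>E\<^esub> (l \<oplus>\<^bsub>E\<^esub> v) = (q \<oplus>\<^bsub>E\<^esub> p) \<oplus>\<^bsub>E\<^esub> (w \<oplus>\<^bsub>E\<^esub> u)"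
    using closed by (simp add: E.M.a_ac)
  then have "l \<oplus>\<^bsub>E\<^esub> v = w \<oplus>\<^bsub>E\<^esub> u"
    using closed by simp
  then have "l = w \<oplus>\<^bsub>E\<^esub> u \<oplus>\<^bsub>E\<^esub> \<ominus>\<^bsub>E\<^esub> v"
    using closed by (simp add: E.M.a_assoc E.M.r_neg flip: \<open>l \<oplus>\<^bsub>E\<^esub> v = w \<oplus>\<^bsub>E\<^esub> u\<close>)
  then show "B (B X Y) (f \<odot>\<^bsub>E\<^esub> Z) =
      f \<odot>\<^bsub>E\<^esub> B (B X Y) Z \<oplus>\<^bsub>E\<^esub> (anch X (anch Y f) \<ominus>\<^bsub>A\<^esub> anch Y (anch X f)) \<odot>\<^bsub>E\<^esub> Z"
    using X Y Z f closed
    by (simp add: defs a_minus_def E.smult_l_distr E.smult_l_minus E.M.a_assoc)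
qed (use X Y f in simp_all)

section \<open>The submodule generated by the squares\<close>

abbreviation sq :: "'e set" where
  "sq \<equiv> squares_submodule A E B"

lemma squares_in_sq: "X \<in> carrier E \<Longrightarrow> B X X \<in> sq"
  by (auto simp: squares_submodule_def submodule_generated_def)

lemma sq_least:
  assumes "submodule M A E" "\<And>X. X \<in> carrier E \<Longrightarrow> B X X \<in> M"
  shows "sq \<subseteq> M"
  using assms by (auto simp: squares_submodule_def submodule_generated_def)

lemma sq_subset: "sq \<subseteq> carrier E"
  by (rule sq_least) (simp_all add: E.carrier_is_submodule)

lemma submodule_sq: "submodule sq A E"
  by (rule E.submoduleI[OF sq_subset])
    (auto simp: squares_submodule_def submodule_generated_def a_inv_def
      dest: submodule.axioms(1) submodule.smult_closed
      intro: subgroup.one_closed[of _ "add_monoid E", simplified]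
        subgroup.m_inv_closed[of _ "add_monoid E", simplified]
        subgroup.m_closed[of _ "add_monoid E", simplified])

lemmas sq_carrier [simp] = subsetD[OF sq_subset]
  and sq_smult [simp] = E.submoduleE(4)[OF submodule_sq]
  and sq_add [simp] = E.submoduleE(5)[OF submodule_sq]
  and sq_uminus [simp] = E.submoduleE(3)[OF submodule_sq]

lemma zero_in_sq: "\<zero>\<^bsub>E\<^esub> \<in> sq"
  using subgroup.one_closed[OF submodule.axioms(1)[OF submodule_sq]] by simp

lemma sq_cancel:
  assumes "x \<oplus>\<^bsub>E\<^esub> n \<in> sq" "n \<in> sq" "x \<in> carrier E"
  shows "x \<in> sq"
proof -
  have "x = (x \<oplus>\<^bsub>E\<^esub> n) \<oplus>\<^bsub>E\<^esub> \<ominus>\<^bsub>E\<^esub> n"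
    using assms by (simp add: E.M.a_assoc E.M.r_neg)
  then show ?thesis
    using assms by (metis sq_add sq_uminus)
qed

text \<open>
  The kernel of the anchor is a submodule by \<open>A\<close>-linearity, and it contains each square because
  \<open>\<rho>(X)\<close> commutes with itself.
\<close>

lemma anchor_sq:
  assumes "X \<in> sq" "f \<in> carrier A"
  shows "anch X f = \<zero>\<^bsub>A\<^esub>"
proof -
  let ?M = "{X \<in> carrier E. \<forall>f\<in>carrier A. anch X f = \<zero>\<^bsub>A\<^esub>}"
  have "anch (\<ominus>\<^bsub>E\<^esub> X) f = \<zero>\<^bsub>A\<^esub>" if "X \<in> ?M" "f \<in> carrier A" for X f
    using that anchor_add[of "\<ominus>\<^bsub>E\<^esub> X" X f] by (simp add: E.M.l_neg anchor_zero)
  then have "submodule ?M A E"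
    by (intro E.submoduleI) (auto simp: anchor_zero anchor_add anchor_smult)
  then have "sq \<subseteq> ?M"
    by (rule sq_least) (simp add: anchor_bracket a_minus_def A.M.r_neg)
  then show ?thesis
    using assms by blast
qed

text \<open>
  Polarization: \<open>[X, Y] + [Y, X] = [X + Y, X + Y] - [X, X] - [Y, Y]\<close>.
\<close>

lemma symmetrized_bracket_in_sq:
  assumes X: "X \<in> carrier E" and Y: "Y \<in> carrier E"
  shows "B X Y \<oplus>\<^bsub>E\<^esub> B Y X \<in> sq"
proof (rule sq_cancel)
  have "(B X Y \<oplus>\<^bsub>E\<^esub> B Y X) \<oplus>\<^bsub>E\<^esub> (B X X \<oplus>\<^bsub>E\<^esub> B Y Y) = B (X \<oplus>\<^bsub>E\<^esub> Y) (X \<oplus>\<^bsub>E\<^esub> Y)"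
    using X Y by (simp add: bracket_add E.M.a_ac)
  then show "(B X Y \<oplus>\<^bsub>E\<^esub> B Y X) \<oplus>\<^bsub>E\<^esub> (B X X \<oplus>\<^bsub>E\<^esub> B Y Y) \<in> sq"
    using X Y by (simp add: squares_in_sq)
qed (use X Y in \<open>simp_all add: squares_in_sq\<close>)

text \<open>
  On a generator, \<open>[X, [Y, Y]] = [[X, Y], Y] + [Y, [X, Y]]\<close> is a symmetrized bracket. The set \<open>?M\<close> is
  restricted to elements of the submodule itself, so that the derivative term in
  \<open>[X, f n] = f [X, n] + \<rho>(X)(f) n\<close> lies in it.
\<close>

lemma bracket_sq_right:
  assumes X: "X \<in> carrier E" and n: "n \<in> sq"
  shows "B X n \<in> sq"
proof -
  let ?M = "{n \<in> sq. \<forall>X\<in>carrier E. B X n \<in> sq}"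
  have "B X (\<ominus>\<^bsub>E\<^esub> n) \<in> sq" if "n \<in> ?M" "X \<in> carrier E" for X n
  proof (rule sq_cancel)
    show "B X (\<ominus>\<^bsub>E\<^esub> n) \<oplus>\<^bsub>E\<^esub> B X n \<in> sq"
      using that by (simp add: bracket_add(2)[symmetric] E.M.l_neg zero_in_sq)
  qed (use that in auto)
  then have "submodule ?M A E"
    by (intro E.submoduleI) (auto simp: zero_in_sq bracket_add bracket_smult)
  then have "sq \<subseteq> ?M"
  proof (rule sq_least)
    fix Y assume Y: "Y \<in> carrier E"
    have "B X (B Y Y) \<in> sq" if "X \<in> carrier E" for X
      using symmetrized_bracket_in_sq[of "B X Y" Y] bracket_jacobi[of X Y Y] that Y by simp
    with Y show "B Y Y \<in> ?M"
      by (simp add: squares_in_sq)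
  qed
  then show ?thesis
    using assms by blast
qed

lemma bracket_sq_left:
  assumes "n \<in> sq" "X \<in> carrier E"
  shows "B n X \<in> sq"
  using assms by (intro sq_cancel[OF symmetrized_bracket_in_sq bracket_sq_right]) simp_all

end

section \<open>Quotients\<close>

locale quotient_by_submodule = E: module A E
  for A :: "('a, 'r) ring_scheme" and E :: "('a, 'e, 't) module_scheme" +
  fixes N :: "'e set"
  assumes submodule: "submodule N A E"
begin

sublocale N: abelian_subgroup N E
  by (intro abelian_subgroupI3 additive_subgroup.intro submodule.axioms(1)[OF submodule]
      E.abelian_group_axioms)

abbreviation Q :: "('a, 'e set) module" where
  "Q \<equiv> quotient_module E N"

abbreviation proj :: "'e \<Rightarrow> 'e set" where
  "proj X \<equiv> N +>\<^bsub>E\<^esub> X"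

lemma proj_eq:
  assumes "X \<in> carrier E" "n \<in> N"
  shows "proj (n \<oplus>\<^bsub>E\<^esub> X) = proj X"
proof -
  have "n \<oplus>\<^bsub>E\<^esub> X \<in> proj X"
    using assms by (auto simp: a_r_coset_def')
  then show ?thesis
    using assms N.a_repr_independence' by metis
qed

lemma proj_memE:
  assumes "x \<in> proj X"
  obtains n where "n \<in> N" "x = n \<oplus>\<^bsub>E\<^esub> X"
  using assms by (auto simp: a_r_coset_def')

text \<open>
  A union over all representatives collapses to its value at one of them once the summand does not
  depend on the representative; this evaluates the operations on cosets.
\<close>

lemma UN_proj:
  assumes "X \<in> carrier E"
    and "\<And>n. n \<in> N \<Longrightarrow> F (n \<oplus>\<^bsub>E\<^esub> X) = F X"
  shows "(\<Union>x\<in>proj X. F x) = F X"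
  using assms N.a_rcos_self by (auto elim!: proj_memE)

lemma carrier_Q: "carrier Q = proj ` carrier E"
  by (auto simp: quotient_module_def A_RCOSETS_def')

lemma add_Q: "\<lbrakk>X \<in> carrier E; Y \<in> carrier E\<rbrakk> \<Longrightarrow> proj X \<oplus>\<^bsub>Q\<^esub> proj Y = proj (X \<oplus>\<^bsub>E\<^esub> Y)"
  by (simp add: quotient_module_def N.a_rcos_sum)

lemma smult_Q:
  assumes "f \<in> carrier A" "X \<in> carrier E"
  shows "f \<odot>\<^bsub>Q\<^esub> proj X = proj (f \<odot>\<^bsub>E\<^esub> X)"
  using assms submodule.smult_closed[OF submodule]
  by (simp add: quotient_module_def UN_proj proj_eq E.smult_r_distr)

lemma zero_Q: "\<zero>\<^bsub>Q\<^esub> = proj \<zero>\<^bsub>E\<^esub>"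
  using N.a_subset by (simp add: quotient_module_def)

lemma module_Q: "module A Q"
proof (rule moduleI)
  show "abelian_group Q"
  proof (rule abelian_groupI)
    fix C assume "C \<in> carrier Q"
    then obtain X where "X \<in> carrier E" "C = proj X"
      by (auto simp: carrier_Q)
    then have "proj (\<ominus>\<^bsub>E\<^esub> X) \<in> carrier Q" "proj (\<ominus>\<^bsub>E\<^esub> X) \<oplus>\<^bsub>Q\<^esub> C = \<zero>\<^bsub>Q\<^esub>"
      by (auto simp: carrier_Q add_Q zero_Q E.M.l_neg)
    then show "\<exists>D\<in>carrier Q. D \<oplus>\<^bsub>Q\<^esub> C = \<zero>\<^bsub>Q\<^esub>"
      by blast
  qed (auto simp: carrier_Q add_Q zero_Q E.M.a_ac)
qed (auto simp: carrier_Q add_Q smult_Q E.is_cring E.smult_l_distr E.smult_r_distr E.smult_assoc1)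

sublocale proj: module_morphism A E Q proj
  by (intro module_morphism.intro E.module_axioms module_Q module_morphism_axioms.intro)
    (auto simp: carrier_Q add_Q smult_Q)

lemma kernel_proj: "a_kernel E Q proj = N"
  using N.a_subset N.a_rcos_self N.a_rcos_const
  by (auto simp: a_kernel_def' quotient_module_def)

text \<open>
  Changing the representatives by elements of \<^term>\<open>N\<close> changes the bracket by brackets with one
  entry in \<^term>\<open>N\<close>, so a two-sided ideal is needed.
\<close>

lemma quotient_bracket_proj:
  assumes closed: "\<And>X Y. \<lbrakk>X \<in> carrier E; Y \<in> carrier E\<rbrakk> \<Longrightarrow> B X Y \<in> carrier E"
    and add: "\<And>X Y Z. \<lbrakk>X \<in> carrier E; Y \<in> carrier E; Z \<in> carrier E\<rbrakk> \<Longrightarrow>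
      B (X \<oplus>\<^bsub>E\<^esub> Y) Z = B X Z \<oplus>\<^bsub>E\<^esub> B Y Z \<and> B X (Y \<oplus>\<^bsub>E\<^esub> Z) = B X Y \<oplus>\<^bsub>E\<^esub> B X Z"
    and ideal: "\<And>n X. \<lbrakk>n \<in> N; X \<in> carrier E\<rbrakk> \<Longrightarrow> B n X \<in> N \<and> B X n \<in> N"
    and X: "X \<in> carrier E" and Y: "Y \<in> carrier E"
  shows "quotient_bracket E N B (proj X) (proj Y) = proj (B X Y)"
proof -
  \<comment> \<open>the second entry is treated for every \<open>Z\<close>, as the first one varies over its coset\<close>
  have inner: "(\<Union>y\<in>proj Y. proj (B Z y)) = proj (B Z Y)" if "Z \<in> carrier E" for Z
    using Y that N.a_subset by (intro UN_proj) (simp_all add: subset_iff add ideal closed proj_eq)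
  have "(\<Union>x\<in>proj X. \<Union>y\<in>proj Y. proj (B x y)) = (\<Union>y\<in>proj Y. proj (B X y))"
    using X Y N.a_subset
    by (intro UN_proj) (simp_all add: subset_iff inner add ideal closed proj_eq)
  then show ?thesis
    using inner[OF X] by (simp add: quotient_bracket_def)
qed

lemma quotient_anchor_proj:
  assumes X: "X \<in> carrier E"
    and "\<And>n. n \<in> N \<Longrightarrow> \<rho> (n \<oplus>\<^bsub>E\<^esub> X) f = \<rho> X f"
  shows "quotient_anchor \<rho> (proj X) f = \<rho> X f"
proof -
  have "(SOME x. x \<in> proj X) \<in> proj X"
    using N.a_rcos_self[OF X] by (rule someI)
  then show ?thesis
    using assms(2) unfolding quotient_anchor_def by (metis proj_memE)
qed

end

theorem theorem4p6p5:
  fixes K :: "('k, 'r) ring_scheme"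
    and A :: "('k, 'a, 's) module_scheme"
    and E :: "('a, 'e, 't) module_scheme"
    and B :: "'e \<Rightarrow> 'e \<Rightarrow> 'e"
  defines "\<rho> \<equiv> anchor A E B"
    and "N \<equiv> squares_submodule A E B"
  defines "E0 \<equiv> E\<lparr>carrier := N\<rparr>"
    and "Q \<equiv> quotient_module E N"
    and "BQ \<equiv> quotient_bracket E N B"
    and "\<rho>Q \<equiv> quotient_anchor \<rho>"
  assumes "field K" and "ring_char_zero K" and "algebra K A"
    and "loday_pseudoalgebra K A E B"
  shows
    "submodule N A E \<and>
     anchored_loday_pseudoalgebra K A E0 B \<rho> \<and>
     anchors_agree A E0 \<rho> (\<lambda>X f. \<zero>\<^bsub>A\<^esub>) \<and>
     (faithful_module A E0 \<longrightarrow>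
        loday_pseudoalgebra K A E0 B \<and> anchors_agree A E0 (anchor A E0 B) \<rho>) \<and>
     anchored_lie_pseudoalgebra K A Q BQ \<rho>Q \<and>
     (faithful_module A Q \<longrightarrow>
        lie_pseudoalgebra K A Q BQ \<and> anchors_agree A Q (anchor A Q BQ) \<rho>Q) \<and>
     loday_morphism K A E0 B \<rho> E B \<rho> (\<lambda>X. X) \<and>
     loday_morphism K A E B \<rho> Q BQ \<rho>Q (\<lambda>X. N +>\<^bsub>E\<^esub> X) \<and>
     short_exact E0 E Q (\<lambda>X. X) (\<lambda>X. N +>\<^bsub>E\<^esub> X)"
proof -
  interpret faithful_loday K A E B
    by (intro faithful_loday.intro assms)
  have sub: "submodule N A E" and NE: "N \<subseteq> carrier E"
    unfolding N_def by (rule submodule_sq, rule sq_subset)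
  interpret quot: quotient_by_submodule A E N
    by (intro quotient_by_submodule.intro quotient_by_submodule_axioms.intro
        E.module_axioms sub)
  have KA: "module K A"
    by (rule A.module)
  have loday_E: "anchored_loday_pseudoalgebra K A E B \<rho>"
    unfolding \<rho>_def by (rule anchored_loday)
  have anchor_N: "\<rho> n f = \<zero>\<^bsub>A\<^esub>" if "n \<in> N" "f \<in> carrier A" for n f
    using that by (simp add: \<rho>_def N_def anchor_sq)
  have ideal: "B n X \<in> N \<and> B X n \<in> N" if "n \<in> N" "X \<in> carrier E" for n X
    using that by (simp add: N_def bracket_sq_left bracket_sq_right)

  have module_E0: "module A E0"
    unfolding E0_def by (rule submodule.submodule_is_module[OF sub E.module_axioms])
  interpret incl: module_morphism A E0 E "\<lambda>X. X"
    using NE by (intro module_morphism.intro module_E0 E.module_axioms module_morphism_axioms.intro)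
      (auto simp: E0_def)
  interpret incl: anchored_morphism A E0 E "\<lambda>X. X" K B \<rho> B \<rho>
  proof (intro anchored_morphism.intro incl.module_morphism_axioms anchored_morphism_axioms.intro KA)
    show "incl.intertwines B B"
      unfolding incl.intertwines_def using NE ideal by (auto simp: E0_def)
  qed simp
  have loday_E0: "anchored_loday_pseudoalgebra K A E0 B \<rho>"
    using loday_E by (intro incl.anchored_loday_inj) simp_all
  have incl_morphism: "loday_morphism K A E0 B \<rho> E B \<rho> (\<lambda>X. X)"
    using loday_E0 loday_E incl.hom_closed
    by (simp add: loday_morphism_def) (simp add: E0_def)

  have BQ: "BQ (quot.proj X) (quot.proj Y) = quot.proj (B X Y)"
    if "X \<in> carrier E" "Y \<in> carrier E" for X Y
    unfolding BQ_def using that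
    by (intro quot.quotient_bracket_proj) (simp_all add: bracket_add ideal)
  have \<rho>Q: "\<rho>Q (quot.proj X) f = \<rho> X f" if "X \<in> carrier E" "f \<in> carrier A" for X f
    unfolding \<rho>Q_def
  proof (rule quot.quotient_anchor_proj[OF that(1)])
    fix n assume "n \<in> N"
    then show "\<rho> (n \<oplus>\<^bsub>E\<^esub> X) f = \<rho> X f"
      using that NE anchor_N by (auto simp: \<rho>_def anchor_add)
  qed
  interpret pr: anchored_morphism A E Q quot.proj K B \<rho> BQ \<rho>Q
    unfolding Q_def
    by (intro anchored_morphism.intro quot.proj.module_morphism_axioms
        anchored_morphism_axioms.intro KA)
      (auto simp: quot.proj.intertwines_def BQ \<rho>Q)
  have loday_Q: "anchored_loday_pseudoalgebra K A Q BQ \<rho>Q"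
    using loday_E by (intro pr.anchored_loday_surj) (simp_all add: Q_def quot.carrier_Q)
  have alternating_Q: "alternating_bracket Q BQ"
    using squares_in_sq
    by (auto simp: alternating_bracket_def Q_def quot.carrier_Q BQ N_def[symmetric] quot.N.a_rcos_const)
       (auto simp: quotient_module_def quot.N.a_rcos_const)
  have proj_morphism: "loday_morphism K A E B \<rho> Q BQ \<rho>Q quot.proj"
    using loday_E loday_Q pr.hom_closed
    by (simp add: loday_morphism_def pr.hom_add pr.hom_smult BQ \<rho>Q)
  have exact: "short_exact E0 E Q (\<lambda>X. X) quot.proj"
    by (simp add: short_exact_def Q_def quot.kernel_proj quot.carrier_Q) (simp add: E0_def)

  show ?thesis
    using sub loday_E0 anchor_N loday_Q alternating_Q incl_morphism proj_morphism exact
      anchored_anchors_agree[of A E0 K B \<rho>] anchored_anchors_agree[of A Q K BQ \<rho>Q]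
    by (simp add: anchored_loday_pseudoalgebra_def anchored_lie_pseudoalgebra_def
        anchored_pseudoalgebra_def loday_pseudoalgebra_def lie_pseudoalgebra_def
        pseudoalgebra_def anchors_agree_def) (simp add: E0_def)
qed

end
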